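(* Let $(G,\mathsf m)$ be a marked graph and let $(K,\mathsf m_K)$ be its core. Then $$D_{(G,\mathsf m)}(\mathbf z,y)=D_{(K,\mathsf m_K)}(\mathbf z,y).$$
   Context: Graphs are finite and may have loops and multiple edges. A mark is a pair $(w,d)$ of integers with $w\ge1,d\ge0,w\ge d+1$, with dot-sum $(w,d)\dotplus(w',d')=(w+w',d+d'+1)$. A marked graph is $(G,\mathsf m)$ with $\mathsf m$ assigning a mark to each vertex; contracting a non-loop edge $e=uv$ merges $u,v$ into a new vertex (inheriting all other incident edges) with mark $\mathsf m(u)\dotplus\mathsf m(v)$. The $M$-polynomial $M_{(G,\mathsf m)}(\mathbf z,y)$ in commuting indeterminates $y$, $z_{w,d}$ is the well-defined polynomial given by: edgeless $G$ with marks $(w_i,d_i)$ gives $\prod_i z_{w_i,d_i}$; a loop $e$ gives $M_{(G,\mathsf m)}=y\,M_{(G\setminus e,\mathsf m)}$; a non-loop edge $e$ gives $M_{(G,\mathsf m)}=M_{(G\setminus e,\mathsf m)}+M_{(G/e,\mathsf m/e)}$. For a mark $(w,d)$ put $D_{\bullet_{w,d}}=\sum_{i=0}^d(-1)^i\binom di z_{w-i,0}z_{1,0}^i$; the $D$-polynomial $D_{(G,\mathsf m)}(\mathbf z,y)$ is obtained from $M_{(G,\mathsf m)}(\mathbf z,y)$ by substituting $z_{w,d}\mapsto D_{\bullet_{w,d}}$ for every mark $(w,d)$. A vertex is absorbable if it has degree $1$ and mark $(1,0)$; an edge is absorbable if it is incident with an absorbable vertex. Absorbing an absorbable edge $e=uv$,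 with $v$ absorbable and $\mathsf m(u)=(w,d)$, means contracting $e$ and giving the resulting vertex the mark $(w+1,d)$, all other marks unchanged. The core $(K,\mathsf m_K)$ of $(G,\mathsf m)$ is the marked graph obtained by absorbing absorbable edges until none remain. *)

theory Defs
  imports "HOL-Library.Poly_Mapping" "HOL-Library.Uprod"
begin

subsection \<open>Marked graphs\<close>

type_synonym mark = "nat \<times> nat"

definition is_mark :: "mark \<Rightarrow> bool" where
  "is_mark m \<longleftrightarrow> 1 \<le> fst m \<and> snd m + 1 \<le> fst m"

definition dot_sum :: "mark \<Rightarrow> mark \<Rightarrow> mark" where
  "dot_sum m n = (fst m + fst n, snd m + snd n + 1)"

text \<open>The end map of an edge takes values in unordered pairs; an edge with ends
  \<open>Upair v v\<close> is a loop at \<open>v\<close>. The values of \<open>ends\<close> off \<open>edges\<close> and of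
  \<open>mark_of\<close> off \<open>verts\<close> are irrelevant.\<close>

record ('v, 'e) mgraph =
  verts :: "'v set"
  edges :: "'e set"
  ends :: "'e \<Rightarrow> 'v uprod"
  mark_of :: "'v \<Rightarrow> mark"

definition marked_graph :: "('v, 'e) mgraph \<Rightarrow> bool" where
  "marked_graph G \<longleftrightarrow> finite (verts G) \<and> finite (edges G) \<and>
     (\<forall>e\<in>edges G. set_uprod (ends G e) \<subseteq> verts G) \<and>
     (\<forall>v\<in>verts G. is_mark (mark_of G v))"

definition delete :: "('v, 'e) mgraph \<Rightarrow> 'e \<Rightarrow> ('v, 'e) mgraph" where
  "delete G e = G\<lparr>edges := edges G - {e}\<rparr>"

text \<open>Contraction of a non-loop edge \<open>e\<close> with ends \<open>u\<close> and \<open>v\<close>. The merged vertex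
  is named \<open>u\<close>; interchanging \<open>u\<close> and \<open>v\<close> only renames it. Edges parallel to \<open>e\<close>
  become loops.\<close>

definition contract :: "('v, 'e) mgraph \<Rightarrow> 'e \<Rightarrow> 'v \<Rightarrow> 'v \<Rightarrow> ('v, 'e) mgraph" where
  "contract G e u v =
     \<lparr>verts = verts G - {v},
      edges = edges G - {e},
      ends = (\<lambda>f. map_uprod (\<lambda>x. if x = v then u else x) (ends G f)),
      mark_of = (mark_of G)(u := dot_sum (mark_of G u) (mark_of G v))\<rparr>"


subsection \<open>Polynomials in the indeterminates $y$ and $z_{w,d}$\<close>

datatype indet = Y | Z mark

type_synonym zpoly = "(indet \<Rightarrow>\<^sub>0 nat) \<Rightarrow>\<^sub>0 int"

definition Var :: "indet \<Rightarrow> zpoly" where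
  "Var x = Poly_Mapping.single (Poly_Mapping.single x 1) 1"

definition substitute :: "(indet \<Rightarrow> zpoly) \<Rightarrow> zpoly \<Rightarrow> zpoly" where
  "substitute s p = (\<Sum>a\<in>Poly_Mapping.keys p. of_int (Poly_Mapping.lookup p a) *
     (\<Prod>x\<in>Poly_Mapping.keys a. s x ^ Poly_Mapping.lookup a x))"


subsection \<open>The $M$-polynomial\<close>

text \<open>\<open>M_rel G p\<close>: some sequence of deletions and contractions computes \<open>p\<close> from \<open>G\<close>.
  Every marked graph has exactly one such \<open>p\<close> (lemma \<open>M_rel_iff\<close>), so that the
  description in \<open>M_poly\<close> is proper.\<close>

inductive M_rel :: "('v, 'e) mgraph \<Rightarrow> zpoly \<Rightarrow> bool" where
  edgeless: "edges G = {} \<Longrightarrow> M_rel G (\<Prod>v\<in>verts G. Var (Z (mark_of G v)))"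
| loop: "\<lbrakk>e \<in> edges G; ends G e = Upair v v; M_rel (delete G e) p\<rbrakk>
    \<Longrightarrow> M_rel G (Var Y * p)"
| nonloop: "\<lbrakk>e \<in> edges G; ends G e = Upair u v; u \<noteq> v;
      M_rel (delete G e) p; M_rel (contract G e u v) q\<rbrakk>
    \<Longrightarrow> M_rel G (p + q)"

definition M_poly :: "('v, 'e) mgraph \<Rightarrow> zpoly" where
  "M_poly G = (THE p. M_rel G p)"


subsection \<open>The $D$-polynomial\<close>

definition D_dot :: "mark \<Rightarrow> zpoly" where
  "D_dot m = (case m of (w, d) \<Rightarrow>
     \<Sum>i=0..d. (-1) ^ i * of_nat (d choose i) * Var (Z (w - i, 0)) * Var (Z (1, 0)) ^ i)"

primrec D_subst :: "indet \<Rightarrow> zpoly" where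
  "D_subst Y = Var Y"
| "D_subst (Z m) = D_dot m"

definition D_poly :: "('v, 'e) mgraph \<Rightarrow> zpoly" where
  "D_poly G = substitute D_subst (M_poly G)"


subsection \<open>Absorption and cores\<close>

text \<open>A loop contributes 2 to the degree of its vertex.\<close>

definition degree :: "('v, 'e) mgraph \<Rightarrow> 'v \<Rightarrow> nat" where
  "degree G v = card {e \<in> edges G. v \<in> set_uprod (ends G e)} +
                card {e \<in> edges G. ends G e = Upair v v}"

definition absorbable_vertex :: "('v, 'e) mgraph \<Rightarrow> 'v \<Rightarrow> bool" where
  "absorbable_vertex G v \<longleftrightarrow> v \<in> verts G \<and> degree G v = 1 \<and> mark_of G v = (1, 0)"

definition absorbable_edge :: "('v, 'e) mgraph \<Rightarrow> 'e \<Rightarrow> bool" where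
  "absorbable_edge G e \<longleftrightarrow> e \<in> edges G \<and> (\<exists>v\<in>set_uprod (ends G e). absorbable_vertex G v)"

definition absorb :: "('v, 'e) mgraph \<Rightarrow> 'e \<Rightarrow> 'v \<Rightarrow> 'v \<Rightarrow> ('v, 'e) mgraph" where
  "absorb G e u v = (contract G e u v)
     \<lparr>mark_of := (mark_of G)(u := (fst (mark_of G u) + 1, snd (mark_of G u)))\<rparr>"

inductive absorb_step :: "('v, 'e) mgraph \<Rightarrow> ('v, 'e) mgraph \<Rightarrow> bool" where
  "\<lbrakk>e \<in> edges G; ends G e = Upair u v; absorbable_vertex G v\<rbrakk>
    \<Longrightarrow> absorb_step G (absorb G e u v)"

text \<open>The core is determined only up to renaming vertices, hence a relation.\<close>

definition is_core :: "('v, 'e) mgraph \<Rightarrow> ('v, 'e) mgraph \<Rightarrow> bool" where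
  "is_core G K \<longleftrightarrow> absorb_step\<^sup>*\<^sup>* G K \<and> (\<nexists>e. absorbable_edge K e)"


subsection \<open>Well-definedness of the $M$-polynomial\<close>

lemma dot_sum_commute: "dot_sum m n = dot_sum n m"
  by (simp add: dot_sum_def)

lemma dot_sum_right_commute: "dot_sum (dot_sum k m) n = dot_sum (dot_sum k n) m"
  by (simp add: dot_sum_def)

lemma is_mark_dot_sum: "is_mark m \<Longrightarrow> is_mark n \<Longrightarrow> is_mark (dot_sum m n)"
  by (simp add: is_mark_def dot_sum_def)

lemma mgraph_eqI:
  fixes G H :: "('v, 'e) mgraph"
  assumes "verts G = verts H" "edges G = edges H" "\<And>e. ends G e = ends H e"
    "\<And>v. mark_of G v = mark_of H v"
  shows "G = H"
  using assms by (intro mgraph.equality) auto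

lemma delete_simps [simp]:
  "verts (delete G e) = verts G" "edges (delete G e) = edges G - {e}"
  "ends (delete G e) = ends G" "mark_of (delete G e) = mark_of G"
  by (simp_all add: delete_def)

lemma contract_simps [simp]:
  "verts (contract G e u v) = verts G - {v}" "edges (contract G e u v) = edges G - {e}"
  "ends (contract G e u v) f = map_uprod (\<lambda>x. if x = v then u else x) (ends G f)"
  "mark_of (contract G e u v) = (mark_of G)(u := dot_sum (mark_of G u) (mark_of G v))"
  by (simp_all add: contract_def)

lemma marked_graph_delete: "marked_graph G \<Longrightarrow> marked_graph (delete G e)"
  by (auto simp: marked_graph_def)

lemma marked_graph_contract:
  assumes "marked_graph G" "e \<in> edges G" "ends G e = Upair u v" "u \<noteq> v"
  shows "marked_graph (contract G e u v)"
proof -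
  have uv: "u \<in> verts G" "v \<in> verts G"
    using assms by (auto simp: marked_graph_def)
  have "set_uprod (map_uprod (\<lambda>x. if x = v then u else x) (ends G f)) \<subseteq> verts G - {v}"
    if "f \<in> edges G" for f
  proof -
    have "set_uprod (ends G f) \<subseteq> verts G"
      using assms(1) that by (auto simp: marked_graph_def)
    then show ?thesis
      using uv assms(4) by (auto simp: uprod.set_map)
  qed
  then show ?thesis
    using assms(1,4) uv by (auto simp: marked_graph_def is_mark_dot_sum)
qed

lemma card_edges_less:
  "marked_graph G \<Longrightarrow> e \<in> edges G \<Longrightarrow> card (edges G - {e}) < card (edges G)"
  unfolding marked_graph_def by (blast intro: card_Diff1_less)

definition renaming :: "('v \<Rightarrow> 'w) \<Rightarrow> ('v, 'e) mgraph \<Rightarrow> ('w, 'e) mgraph \<Rightarrow> bool" where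
  "renaming f G H \<longleftrightarrow> inj_on f (verts G) \<and> verts H = f ` verts G \<and> edges H = edges G \<and>
     (\<forall>e\<in>edges G. ends H e = map_uprod f (ends G e)) \<and>
     (\<forall>v\<in>verts G. mark_of H (f v) = mark_of G v)"

lemma renaming_delete: "renaming f G H \<Longrightarrow> renaming f (delete G e) (delete H e)"
  by (auto simp: renaming_def)

lemma renaming_contract:
  assumes "marked_graph G" "renaming f G H" "e \<in> edges G" "ends G e = Upair u v" "u \<noteq> v"
  shows "renaming f (contract G e u v) (contract H e (f u) (f v))"
proof -
  have uv: "u \<in> verts G" "v \<in> verts G"
    using assms by (auto simp: marked_graph_def)
  have inj: "inj_on f (verts G)"
    using assms(2) by (simp add: renaming_def)
  have "ends (contract H e (f u) (f v)) g = map_uprod f (ends (contract G e u v) g)"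
    if "g \<in> edges G" for g
  proof -
    obtain a b where ab: "ends G g = Upair a b" by (cases "ends G g")
    moreover have "a \<in> verts G" "b \<in> verts G"
      using ab assms(1) that by (auto simp: marked_graph_def)
    moreover have "ends H g = Upair (f a) (f b)"
      using ab assms(2) that by (simp add: renaming_def)
    ultimately show ?thesis
      using uv inj by (auto simp: inj_on_eq_iff)
  qed
  moreover have "f ` verts G - {f v} = f ` (verts G - {v})"
    using inj uv by (auto simp: inj_on_def)
  ultimately show ?thesis
    using assms(2) uv inj
    by (auto simp: renaming_def inj_on_eq_iff intro: inj_on_subset)
qed

lemma M_rel_renaming:
  assumes "M_rel G p" "marked_graph G" "renaming f G H"
  shows "M_rel H p"
  using assms
proof (induction G p arbitrary: H rule: M_rel.induct)
  case (edgeless G)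
  have "(\<Prod>v\<in>verts H. Var (Z (mark_of H v))) = (\<Prod>v\<in>verts G. Var (Z (mark_of G v)))"
    using edgeless.prems by (simp add: renaming_def prod.reindex)
  moreover have "edges H = {}"
    using edgeless by (simp add: renaming_def)
  ultimately show ?case
    using M_rel.edgeless by metis
next
  case (loop e G v p)
  have "M_rel (delete H e) p"
    using loop by (simp add: marked_graph_delete renaming_delete)
  moreover have "e \<in> edges H" "ends H e = Upair (f v) (f v)"
    using loop by (auto simp: renaming_def)
  ultimately show ?case
    by (rule M_rel.loop[rotated 2])
next
  case (nonloop e G u v p q)
  have "M_rel (delete H e) p"
    using nonloop by (simp add: marked_graph_delete renaming_delete)
  moreover have "M_rel (contract H e (f u) (f v)) q"
    using nonloop by (simp add: marked_graph_contract renaming_contract)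
  moreover have "e \<in> edges H" "ends H e = Upair (f u) (f v)"
    using nonloop by (auto simp: renaming_def)
  moreover have "f u \<noteq> f v"
    using nonloop by (auto simp: renaming_def marked_graph_def inj_on_def)
  ultimately show ?case
    by (intro M_rel.nonloop)
qed

lemma renaming_swap:
  assumes "marked_graph G" "e \<in> edges G" "ends G e = Upair u v" "u \<noteq> v"
  shows "renaming (\<lambda>x. if x = u then v else x) (contract G e u v) (contract G e v u)"
proof -
  have uv: "u \<in> verts G" "v \<in> verts G"
    using assms by (auto simp: marked_graph_def)
  have "ends (contract G e v u) g =
      map_uprod (\<lambda>x. if x = u then v else x) (ends (contract G e u v) g)" for g
    using assms(4) by (cases "ends G g") auto
  then show ?thesis
    using uv assms(4) by (auto simp: renaming_def inj_on_def dot_sum_commute)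
qed

lemma M_rel_exists: "marked_graph G \<Longrightarrow> \<exists>p. M_rel G p"
proof (induction "card (edges G)" arbitrary: G rule: less_induct)
  case less
  show ?case
  proof (cases "edges G = {}")
    case True
    then show ?thesis using M_rel.edgeless by blast
  next
    case False
    then obtain e where e: "e \<in> edges G" by blast
    have c: "card (edges G - {e}) < card (edges G)"
      using e less.prems by (blast intro: card_edges_less)
    obtain p where p: "M_rel (delete G e) p"
      using less.hyps[of "delete G e"] less.prems c by (auto simp: marked_graph_delete)
    obtain u v where uv: "ends G e = Upair u v" by (cases "ends G e")
    show ?thesis
    proof (cases "u = v")
      case True
      then show ?thesis using M_rel.loop[OF e _ p] uv by auto
    next
      case False
      then obtain q where "M_rel (contract G e u v) q"
        using less.hyps[of "contract G e u v"] less.prems c e uv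
        by (auto simp: marked_graph_contract)
      then show ?thesis using M_rel.nonloop[OF e uv False p] by blast
    qed
  qed
qed

lemma contract_delete_commute: "delete (contract G e u v) f = contract (delete G f) e u v"
  by (rule mgraph_eqI) auto

lemma delete_commute: "delete (delete G e) f = delete (delete G f) e"
  by (rule mgraph_eqI) auto

lemma contract_parallel: "delete (contract G e u v) f = delete (contract G f u v) e"
  by (rule mgraph_eqI) auto

lemma contract_commute_adjacent:
  assumes "u \<noteq> v" "u \<noteq> x" "v \<noteq> x"
  shows "contract (contract G e u v) f u x = contract (contract G f u x) e u v"
proof (rule mgraph_eqI)
  show "ends (contract (contract G e u v) f u x) g =
      ends (contract (contract G f u x) e u v) g" for g
    using assms by (cases "ends G g") auto
qed (use assms in \<open>auto simp: dot_sum_right_commute\<close>)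

lemma contract_commute_disjoint:
  assumes "u \<noteq> v" "x \<noteq> y" "{u, v} \<inter> {x, y} = {}"
  shows "contract (contract G e u v) f x y = contract (contract G f x y) e u v"
proof (rule mgraph_eqI)
  show "ends (contract (contract G e u v) f x y) g =
      ends (contract (contract G f x y) e u v) g" for g
    using assms by (cases "ends G g") auto
qed (use assms in auto)

lemma M_rel_unique:
  fixes G :: "('v, 'e) mgraph"
  shows "marked_graph G \<Longrightarrow> M_rel G p \<Longrightarrow> M_rel G q \<Longrightarrow> p = q"
proof (induction "card (edges G)" arbitrary: G p q rule: less_induct)
  case less
  let ?small = "\<lambda>H :: ('v, 'e) mgraph. marked_graph H \<and> card (edges H) < card (edges G)"
  have iff: "M_rel H r \<longleftrightarrow> r = M_poly H" if "?small H" for H :: "('v, 'e) mgraph" and r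
  proof -
    obtain r0 where "M_rel H r0" using M_rel_exists \<open>?small H\<close> by blast
    moreover from this have "r' = r0" if "M_rel H r'" for r'
      using less.hyps that \<open>?small H\<close> by blast
    ultimately show ?thesis
      unfolding M_poly_def by (metis theI)
  qed
  have del: "?small (delete H e)"
    if "?small H \<or> H = G" "e \<in> edges H" for H :: "('v, 'e) mgraph" and e
  proof -
    have "marked_graph H" using that less.prems by blast
    then have "card (edges H - {e}) < card (edges H)"
      using that by (blast intro: card_edges_less)
    then show ?thesis using that \<open>marked_graph H\<close> by (auto simp: marked_graph_delete)
  qed
  have con: "?small (contract H e u v)"
    if "?small H \<or> H = G" "e \<in> edges H" "ends H e = Upair u v" "u \<noteq> v"
    for H :: "('v, 'e) mgraph" and e u v
    using del[OF that(1,2)] that less.prems by (auto simp: marked_graph_contract)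
  have Mloop: "M_poly H = Var Y * M_poly (delete H e)"
    if "?small H" "e \<in> edges H" "ends H e = Upair v v" for H :: "('v, 'e) mgraph" and e v
    using M_rel.loop[OF that(2,3)] iff that del[of H e] by metis
  have Mnon: "M_poly H = M_poly (delete H e) + M_poly (contract H e u v)"
    if "?small H" "e \<in> edges H" "ends H e = Upair u v" "u \<noteq> v"
    for H :: "('v, 'e) mgraph" and e u v
    using M_rel.nonloop[OF that(2-4)] iff that del[of H e] con[of H e u v] by metis
  have swap: "M_poly (contract G e u v) = M_poly (contract G e v u)"
    if "e \<in> edges G" "ends G e = Upair u v" "u \<noteq> v" for e u v
  proof -
    have uv: "?small (contract G e u v)" using con that by blast
    have vu: "?small (contract G e v u)" using con[of G e v u] that by auto
    have "M_rel (contract G e u v) (M_poly (contract G e u v))" using iff uv by blast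
    then have "M_rel (contract G e v u) (M_poly (contract G e u v))"
      using M_rel_renaming renaming_swap[OF less.prems(1) that] uv by blast
    then show ?thesis using iff vu by blast
  qed
  define val where "val e r \<longleftrightarrow>
      (\<exists>v. ends G e = Upair v v \<and> r = Var Y * M_poly (delete G e)) \<or>
      (\<exists>u v. ends G e = Upair u v \<and> u \<noteq> v \<and>
         r = M_poly (delete G e) + M_poly (contract G e u v))" for e r
  have cases: "(edges G = {} \<and> r = (\<Prod>v\<in>verts G. Var (Z (mark_of G v)))) \<or>
      (\<exists>e\<in>edges G. val e r)" if "M_rel G r" for r
    using that
  proof cases
    case edgeless
    then show ?thesis by blast
  next
    case (loop e v p)
    then have "p = M_poly (delete G e)" using iff del[of G e] by blast
    then have "val e r" using loop unfolding val_def by auto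
    then show ?thesis using loop by blast
  next
    case (nonloop e u v p q)
    then have "p = M_poly (delete G e)" "q = M_poly (contract G e u v)"
      using iff del[of G e] con[of G e u v] by blast+
    then have "val e r" using nonloop unfolding val_def by auto
    then show ?thesis using nonloop by blast
  qed
  have val_loop: "r = Var Y * M_poly (delete G e)"
    if "val e r" "ends G e = Upair v v" for e v r
    using that unfolding val_def by auto
  have val_non: "r = M_poly (delete G e) + M_poly (contract G e u v)"
    if "val e r" "e \<in> edges G" "ends G e = Upair u v" "u \<noteq> v" for e u v r
    using that swap[of e u v] unfolding val_def by auto
  have loop_non: "r = s"
    if "e \<in> edges G" "f \<in> edges G" "val e r" "val f s" "ends G e = Upair a a"
      "ends G f = Upair u v" "u \<noteq> v" for e f r s a u v
  proof -
    have "e \<noteq> f" using that by auto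
    have "r = Var Y * M_poly (delete G e)" using val_loop that by blast
    also have "M_poly (delete G e) =
        M_poly (delete (delete G e) f) + M_poly (contract (delete G e) f u v)"
      using Mnon[of "delete G e" f u v] del[of G e] that \<open>e \<noteq> f\<close> by auto
    finally have r: "r = Var Y * \<dots>" .
    have "s = M_poly (delete G f) + M_poly (contract G f u v)" using val_non that by blast
    also have "M_poly (delete G f) = Var Y * M_poly (delete (delete G f) e)"
      using Mloop[of "delete G f" e a] del[of G f] that \<open>e \<noteq> f\<close> by auto
    also have "M_poly (contract G f u v) = Var Y * M_poly (delete (contract G f u v) e)"
      using Mloop[of "contract G f u v" e "if a = v then u else a"] con[of G f u v] that \<open>e \<noteq> f\<close>
      by auto
    finally show ?thesis
      using r delete_commute[of G e f] contract_delete_commute[of G f u v e]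
      by (simp add: distrib_left)
  qed
  have val_eq: "r = s" if "e \<in> edges G" "f \<in> edges G" "val e r" "val f s" for e f r s
  proof -
    obtain u v where e: "ends G e = Upair u v" by (cases "ends G e")
    obtain x y where f: "ends G f = Upair x y" by (cases "ends G f")
    consider "e = f" | "e \<noteq> f" "u = v" "x = y" | "u = v" "x \<noteq> y" | "u \<noteq> v" "x = y"
      | "e \<noteq> f" "u \<noteq> v" "x \<noteq> y" by blast
    then show ?thesis
    proof cases
      case 1
      then show ?thesis
        using val_loop[of e r u] val_loop[of e s u] val_non[of e r u v] val_non[of e s u v] that e
        by (cases "u = v") auto
    next
      case 2
      have "M_poly (delete G e) = Var Y * M_poly (delete (delete G e) f)"
        using Mloop[of "delete G e" f x] del[of G e] that 2 f by auto
      moreover have "M_poly (delete G f) = Var Y * M_poly (delete (delete G f) e)"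
        using Mloop[of "delete G f" e u] del[of G f] that 2 e by auto
      ultimately show ?thesis
        using val_loop[of e r u] val_loop[of f s x] that e f 2 delete_commute[of G e f] by auto
    next
      case 3
      then show ?thesis using loop_non[of e f r s u x y] that e f by auto
    next
      case 4
      then show ?thesis using loop_non[of f e s r x u v] that e f by auto
    next
      case 5
      have main: "r = s" if e': "ends G e = Upair u v" "u \<noteq> v" and f': "ends G f = Upair x y" "x \<noteq> y"
        and sh: "(u = x \<and> v = y) \<or> (u = x \<and> v \<noteq> y) \<or> {u, v} \<inter> {x, y} = {}" for u v x y
      proof -
        note ef = \<open>e \<in> edges G\<close> \<open>f \<in> edges G\<close> \<open>e \<noteq> f\<close>
        have r: "r = M_poly (delete G e) + M_poly (contract G e u v)"
          using val_non \<open>val e r\<close> ef e' by blast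
        have s: "s = M_poly (delete G f) + M_poly (contract G f x y)"
          using val_non \<open>val f s\<close> ef f' by blast
        have de: "M_poly (delete G e) =
            M_poly (delete (delete G e) f) + M_poly (contract (delete G e) f x y)"
          using Mnon[of "delete G e" f x y] del[of G e] ef f' by auto
        have df: "M_poly (delete G f) =
            M_poly (delete (delete G f) e) + M_poly (contract (delete G f) e u v)"
          using Mnon[of "delete G f" e u v] del[of G f] ef e' by auto
        show ?thesis
        proof (cases "u = x \<and> v = y")
          case True
          have "M_poly (contract G e u v) = Var Y * M_poly (delete (contract G e u v) f)"
            using Mloop[of "contract G e u v" f u] con[of G e u v] ef e' f' True by auto
          moreover have "M_poly (contract G f u v) = Var Y * M_poly (delete (contract G f u v) e)"
            using Mloop[of "contract G f u v" e u] con[of G f u v] ef e' f' True by auto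
          moreover have "delete (contract G e u v) f = delete (contract G f u v) e"
            by (rule contract_parallel)
          ultimately show ?thesis
            using r s de df True delete_commute[of G e f]
              contract_delete_commute[of G f u v e] contract_delete_commute[of G e u v f]
            by auto
        next
          case False
          have "ends (contract G e u v) f = Upair x y"
            using f' sh False e' by auto
          then have ce: "M_poly (contract G e u v) = M_poly (delete (contract G e u v) f) +
              M_poly (contract (contract G e u v) f x y)"
            using Mnon[of "contract G e u v" f x y] con[of G e u v] ef e' f' by auto
          have "ends (contract G f x y) e = Upair u v"
            using f' sh False e' by auto
          then have cf: "M_poly (contract G f x y) = M_poly (delete (contract G f x y) e) +
              M_poly (contract (contract G f x y) e u v)"
            using Mnon[of "contract G f x y" e u v] con[of G f x y] ef e' f' by auto
          have "contract (contract G e u v) f x y = contract (contract G f x y) e u v"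
          proof (cases "u = x")
            case True
            then show ?thesis
              using contract_commute_adjacent[of u v y G e f] sh False e' f' by auto
          next
            case False
            then show ?thesis
              using contract_commute_disjoint[of u v x y G e f] sh e' f' by auto
          qed
          then show ?thesis
            using r s de df ce cf delete_commute[of G e f]
              contract_delete_commute[of G f x y e] contract_delete_commute[of G e u v f]
            by (simp add: algebra_simps)
        qed
      qed
      consider "u = x" | "u = y" | "v = x" | "v = y" | "{u, v} \<inter> {x, y} = {}" by blast
      then show ?thesis
      proof cases
        case 1 then show ?thesis using main[of u v x y] e f 5 by auto
      next
        case 2 then show ?thesis using main[of u v y x] e f 5 by auto
      next
        case 3 then show ?thesis using main[of v u x y] e f 5 by auto
      next
        case 4 then show ?thesis using main[of v u y x] e f 5 by auto
      next
        case 5 then show ?thesis using main[of u v x y] e f \<open>u \<noteq> v\<close> \<open>x \<noteq> y\<close> by auto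
      qed
    qed
  qed
  show ?case
    using cases[OF less.prems(2)] cases[OF less.prems(3)] val_eq by auto
qed

lemma M_rel_iff:
  assumes "marked_graph G"
  shows "M_rel G p \<longleftrightarrow> p = M_poly G"
proof -
  obtain q where "M_rel G q" using M_rel_exists[OF assms] by blast
  moreover from this have "r = q" if "M_rel G r" for r
    using M_rel_unique[OF assms] that by blast
  ultimately show ?thesis
    unfolding M_poly_def by (metis theI)
qed

lemma M_poly_edgeless:
  "\<lbrakk>marked_graph G; edges G = {}\<rbrakk> \<Longrightarrow> M_poly G = (\<Prod>v\<in>verts G. Var (Z (mark_of G v)))"
  using M_rel.edgeless M_rel_iff by metis

lemma M_poly_loop:
  "\<lbrakk>marked_graph G; e \<in> edges G; ends G e = Upair v v\<rbrakk>
    \<Longrightarrow> M_poly G = Var Y * M_poly (delete G e)"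
  using M_rel.loop M_rel_iff marked_graph_delete by metis

lemma M_poly_nonloop:
  "\<lbrakk>marked_graph G; e \<in> edges G; ends G e = Upair u v; u \<noteq> v\<rbrakk>
    \<Longrightarrow> M_poly G = M_poly (delete G e) + M_poly (contract G e u v)"
  using M_rel.nonloop M_rel_iff marked_graph_delete marked_graph_contract by metis


subsection \<open>Existence of cores\<close>

lemma absorbable_vertex_not_loop:
  assumes "marked_graph G" "e \<in> edges G" "ends G e = Upair u v" "absorbable_vertex G v"
  shows "u \<noteq> v"
proof
  assume "u = v"
  have fin: "finite (edges G)" using assms(1) by (simp add: marked_graph_def)
  have "e \<in> {e \<in> edges G. v \<in> set_uprod (ends G e)}" "e \<in> {e \<in> edges G. ends G e = Upair v v}"
    using assms \<open>u = v\<close> by auto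
  then have "0 < card {e \<in> edges G. v \<in> set_uprod (ends G e)}"
      "0 < card {e \<in> edges G. ends G e = Upair v v}"
    using fin by (auto simp: card_gt_0_iff)
  then show False
    using assms(4) by (simp add: absorbable_vertex_def degree_def)
qed

lemma marked_graph_absorb:
  assumes "marked_graph G" "e \<in> edges G" "ends G e = Upair u v" "absorbable_vertex G v"
  shows "marked_graph (absorb G e u v)"
  using marked_graph_contract[OF assms(1-3) absorbable_vertex_not_loop[OF assms]] assms(1-3)
  by (auto simp: marked_graph_def absorb_def is_mark_def)

lemma core_exists: "marked_graph G \<Longrightarrow> \<exists>K. is_core G K"
proof (induction "card (edges G)" arbitrary: G rule: less_induct)
  case less
  show ?case
  proof (cases "\<exists>e. absorbable_edge G e")
    case False
    then show ?thesis unfolding is_core_def by blast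
  next
    case True
    then obtain e v where e: "e \<in> edges G" "v \<in> set_uprod (ends G e)" "absorbable_vertex G v"
      by (auto simp: absorbable_edge_def)
    obtain u where u: "ends G e = Upair u v"
      using e(2) by (cases "ends G e") auto
    have "card (edges (absorb G e u v)) < card (edges G)"
      using card_edges_less[OF less.prems e(1)] unfolding absorb_def by simp
    then obtain K where "is_core (absorb G e u v) K"
      using less.hyps marked_graph_absorb[OF less.prems e(1) u e(3)] by blast
    moreover have "absorb_step G (absorb G e u v)"
      by (rule absorb_step.intros[OF e(1) u e(3)])
    ultimately show ?thesis
      unfolding is_core_def by (meson converse_rtranclp_into_rtranclp)
  qed
qed

end

theory Submission
  imports Defs
begin

text \<open>The substitution defining the D-polynomial is a ring homomorphism, so the D-polynomial obeys
  the same deletion--contraction recursion as the M-polynomial. Deleting and contracting edges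
  other than a given absorbable edge commutes with absorbing it, which reduces the theorem to a
  graph whose only edge is absorbable. There it is Pascal's rule, in the form
  \<open>D_dot (w + 1, d + 1) = D_dot (w + 1, d) - z\<^sub>1\<^sub>0 D_dot (w, d)\<close>.\<close>

section \<open>Substitution is a ring homomorphism\<close>

definition monomial_value :: "(indet \<Rightarrow> zpoly) \<Rightarrow> (indet \<Rightarrow>\<^sub>0 nat) \<Rightarrow> zpoly" where
  "monomial_value s a = (\<Prod>x\<in>Poly_Mapping.keys a. s x ^ Poly_Mapping.lookup a x)"

text \<open>Factors outside \<open>keys a\<close> have exponent 0. A common index set lets products
  for different monomials be combined factor by factor.\<close>

lemma monomial_value_superset:
  assumes "finite A" "Poly_Mapping.keys a \<subseteq> A"
  shows "monomial_value s a = (\<Prod>x\<in>A. s x ^ Poly_Mapping.lookup a x)"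
  unfolding monomial_value_def
  using assms by (intro prod.mono_neutral_left) (auto simp: in_keys_iff)

lemma monomial_value_add:
  "monomial_value s (a + b) = monomial_value s a * monomial_value s b"
proof -
  let ?A = "Poly_Mapping.keys a \<union> Poly_Mapping.keys b"
  have "monomial_value s (a + b) = (\<Prod>x\<in>?A. s x ^ Poly_Mapping.lookup (a + b) x)"
    using Poly_Mapping.keys_add[of a b] by (intro monomial_value_superset) auto
  also have "\<dots> = (\<Prod>x\<in>?A. s x ^ Poly_Mapping.lookup a x) * (\<Prod>x\<in>?A. s x ^ Poly_Mapping.lookup b x)"
    by (simp add: lookup_add power_add prod.distrib)
  also have "\<dots> = monomial_value s a * monomial_value s b"
    by (simp add: monomial_value_superset[of ?A])
  finally show ?thesis .
qed

text \<open>Coefficients may cancel in a sum, so \<open>keys (p + q)\<close> can be smaller than the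
  union of the key sets. Extra terms have coefficient 0, so all three sums can run over that
  union.\<close>

lemma substitute_superset:
  assumes "finite A" "Poly_Mapping.keys p \<subseteq> A"
  shows "substitute s p = (\<Sum>a\<in>A. of_int (Poly_Mapping.lookup p a) * monomial_value s a)"
  unfolding substitute_def monomial_value_def
  using assms by (intro sum.mono_neutral_left) (auto simp: in_keys_iff)

lemma substitute_add: "substitute s (p + q) = substitute s p + substitute s q"
proof -
  let ?A = "Poly_Mapping.keys p \<union> Poly_Mapping.keys q"
  have "substitute s (p + q) =
      (\<Sum>a\<in>?A. of_int (Poly_Mapping.lookup (p + q) a) * monomial_value s a)"
    using Poly_Mapping.keys_add[of p q] by (intro substitute_superset) auto
  also have "\<dots> = (\<Sum>a\<in>?A. of_int (Poly_Mapping.lookup p a) * monomial_value s a)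
      + (\<Sum>a\<in>?A. of_int (Poly_Mapping.lookup q a) * monomial_value s a)"
    by (simp add: lookup_add distrib_right sum.distrib)
  also have "\<dots> = substitute s p + substitute s q"
    by (simp add: substitute_superset[of ?A])
  finally show ?thesis .
qed

lemma substitute_single:
  "substitute s (Poly_Mapping.single a c) = of_int c * monomial_value s a"
  by (simp add: substitute_superset[of "{a}"])

lemma substitute_Var [simp]: "substitute s (Var x) = s x"
  by (simp add: Var_def substitute_single monomial_value_superset[of "{x}"])

lemma substitute_one [simp]: "substitute s 1 = 1"
  using substitute_single[of s 0 1] by (simp add: monomial_value_def)

text \<open>Recasts the induction by \<open>update\<close> at a fresh key as one by adding a single
  term, the form suited to additive maps.\<close>

lemma zpoly_induct [case_names zero single_add]:
  fixes p :: zpoly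
  assumes "P 0" and "\<And>a c p. P p \<Longrightarrow> P (Poly_Mapping.single a c + p)"
  shows "P p"
proof (induction p rule: update_induct)
  case const
  show ?case by (fact assms(1))
next
  case (update p a c)
  have "Poly_Mapping.update a c p = Poly_Mapping.single a c + p"
    using update.hyps
    by (intro poly_mapping_eqI) (auto simp: lookup_update lookup_add lookup_single in_keys_iff)
  then show ?case using assms(2) update.IH by simp
qed

lemma substitute_zero [simp]: "substitute s 0 = 0"
  by (simp add: substitute_def)

text \<open>Both sides are additive in \<open>p\<close> and in \<open>q\<close>, so the claim
  reduces to two single terms, where exponents add.\<close>

lemma substitute_mult: "substitute s (p * q) = substitute s p * substitute s q"
proof (induction p rule: zpoly_induct)
  case zero
  show ?case by simp
next
  case (single_add a c p)
  have "substitute s (Poly_Mapping.single a c * q) =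
      substitute s (Poly_Mapping.single a c) * substitute s q"
  proof (induction q rule: zpoly_induct)
    case zero
    show ?case by simp
  next
    case (single_add b d q)
    then show ?case
      by (simp add: distrib_left substitute_add mult_single substitute_single monomial_value_add
          mult_ac)
  qed
  with single_add show ?case by (simp add: distrib_right substitute_add)
qed

lemma substitute_prod: "substitute s (\<Prod>i\<in>I. f i) = (\<Prod>i\<in>I. substitute s (f i))"
  by (induction I rule: infinite_finite_induct) (simp_all add: substitute_mult)

section \<open>Deletion--contraction for the D-polynomial\<close>

lemma D_poly_edgeless:
  "\<lbrakk>marked_graph G; edges G = {}\<rbrakk> \<Longrightarrow> D_poly G = (\<Prod>v\<in>verts G. D_dot (mark_of G v))"
  by (simp add: D_poly_def M_poly_edgeless substitute_prod)

lemma D_poly_loop: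
  "\<lbrakk>marked_graph G; e \<in> edges G; ends G e = Upair v v\<rbrakk>
    \<Longrightarrow> D_poly G = Var Y * D_poly (delete G e)"
  by (simp add: D_poly_def M_poly_loop[of G e v] substitute_mult)

lemma D_poly_nonloop:
  "\<lbrakk>marked_graph G; e \<in> edges G; ends G e = Upair u v; u \<noteq> v\<rbrakk>
    \<Longrightarrow> D_poly G = D_poly (delete G e) + D_poly (contract G e u v)"
  by (simp add: D_poly_def M_poly_nonloop[of G e u v] substitute_add)

lemma D_dot_one_zero: "D_dot (1, 0) = Var (Z (1, 0))"
  by (simp add: D_dot_def)

text \<open>Deletion--contraction for one pendant edge: the product belongs to the deletion, the
  last term to the contraction, and the left side to the absorption.\<close>

lemma D_dot_Suc_Suc:
  "D_dot (Suc w, d) = D_dot (w, d) * D_dot (1, 0) + D_dot (Suc w, Suc d)"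
proof -
  let ?t = "\<lambda>w d i. (-1) ^ i * of_nat (d choose i) * Var (Z (w - i, 0)) * Var (Z (1, 0)) ^ i"
  have "D_dot (Suc w, Suc d) = Var (Z (Suc w, 0)) + (\<Sum>i\<le>d. ?t (Suc w) (Suc d) (Suc i))"
    by (simp add: D_dot_def atLeast0AtMost sum.atMost_Suc_shift del: sum.atMost_Suc)
  \<comment> \<open>Pascal's rule splits \<open>Suc d choose Suc i\<close>. In the second part
    \<open>Suc w - Suc i = w - i\<close>, and the extra factor -1 gives the minus sign.\<close>
  also have "(\<Sum>i\<le>d. ?t (Suc w) (Suc d) (Suc i)) =
      (\<Sum>i\<le>d. ?t (Suc w) d (Suc i)) - (\<Sum>i\<le>d. ?t w d i) * Var (Z (1, 0))"
    unfolding sum_distrib_right sum_subtractf[symmetric]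
    by (intro sum.cong refl) (simp add: algebra_simps)
  \<comment> \<open>The separate summand is the term for i = 0. The new top term, at
    \<open>Suc d\<close>, vanishes because \<open>d choose Suc d\<close> is 0.\<close>
  also have "Var (Z (Suc w, 0)) + \<dots> =
      (\<Sum>i\<le>Suc d. ?t (Suc w) d i) - (\<Sum>i\<le>d. ?t w d i) * Var (Z (1, 0))"
    by (simp add: sum.atMost_Suc_shift del: sum.atMost_Suc)
  also have "\<dots> = D_dot (Suc w, d) - D_dot (w, d) * D_dot (1, 0)"
    by (simp add: D_dot_one_zero) (simp add: D_dot_def atLeast0AtMost binomial_eq_0)
  finally show ?thesis by simp
qed

section \<open>Invariance under absorption\<close>

lemma absorb_simps [simp]:
  "verts (absorb G e u v) = verts G - {v}" "edges (absorb G e u v) = edges G - {e}"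
  "ends (absorb G e u v) f = map_uprod (\<lambda>x. if x = v then u else x) (ends G f)"
  "mark_of (absorb G e u v) = (mark_of G)(u := (fst (mark_of G u) + 1, snd (mark_of G u)))"
  by (simp_all add: absorb_def)

lemma delete_absorb: "delete (absorb G e u v) f = absorb (delete G f) e u v"
  by (rule mgraph_eqI) auto

text \<open>Contraction drops the name \<open>y\<close>, so \<open>u\<close> must not be
  \<open>y\<close>. If \<open>x = u\<close>, the marks agree because raising the weight by 1
  commutes with \<open>dot_sum\<close>.\<close>

lemma contract_absorb:
  assumes "u \<noteq> v" "x \<noteq> v" "y \<noteq> v" "y \<noteq> u"
  shows "contract (absorb G e u v) f x y = absorb (contract G f x y) e u v"
proof (rule mgraph_eqI)
  show "ends (contract (absorb G e u v) f x y) g = ends (absorb (contract G f x y) e u v) g" for g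
    using assms by (cases "ends G g") auto
qed (use assms in \<open>auto simp: dot_sum_def\<close>)

text \<open>A form of "degree 1" without cardinalities, which passes directly to deletions and
  contractions of other edges.\<close>

definition pendant :: "('v, 'e) mgraph \<Rightarrow> 'e \<Rightarrow> 'v \<Rightarrow> 'v \<Rightarrow> bool" where
  "pendant G e u v \<longleftrightarrow> e \<in> edges G \<and> ends G e = Upair u v \<and> u \<noteq> v \<and>
     (\<forall>f\<in>edges G. f \<noteq> e \<longrightarrow> v \<notin> set_uprod (ends G f))"

text \<open>A second edge at \<open>v\<close> would make the first summand of \<open>degree\<close>
  at least 2.\<close>

lemma absorbable_vertex_pendant:
  assumes "marked_graph G" "e \<in> edges G" "ends G e = Upair u v" "absorbable_vertex G v"
  shows "pendant G e u v"
proof -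
  let ?I = "{f \<in> edges G. v \<in> set_uprod (ends G f)}"
  have "f = e" if "f \<in> edges G" "v \<in> set_uprod (ends G f)" for f
  proof -
    have "card {e, f} \<le> card ?I"
      using assms that by (intro card_mono) (auto simp: marked_graph_def)
    also have "card ?I \<le> 1"
      using assms(4) by (simp add: absorbable_vertex_def degree_def)
    finally show ?thesis by (cases "f = e") auto
  qed
  then show ?thesis
    using assms(2,3) absorbable_vertex_not_loop[OF assms] unfolding pendant_def by blast
qed

lemma pendant_delete: "pendant G e u v \<Longrightarrow> f \<noteq> e \<Longrightarrow> pendant (delete G f) e u v"
  by (auto simp: pendant_def)

lemma pendant_contract:
  assumes "pendant G e u v" "f \<noteq> e" "x \<noteq> v" "y \<noteq> v" "y \<noteq> u"
  shows "pendant (contract G f x y) e u v"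
  using assms by (auto simp: pendant_def uprod.set_map)

lemma marked_graph_absorb_pendant:
  assumes "marked_graph G" "pendant G e u v"
  shows "marked_graph (absorb G e u v)"
  using marked_graph_contract[of G e u v] assms
  by (auto simp: marked_graph_def pendant_def is_mark_def)

lemma D_poly_absorb_pendant:
  "\<lbrakk>marked_graph G; pendant G e u v; mark_of G v = (1, 0)\<rbrakk>
    \<Longrightarrow> D_poly G = D_poly (absorb G e u v)"
proof (induction "card (edges G)" arbitrary: G rule: less_induct)
  case less
  note G = \<open>marked_graph G\<close> and pend = \<open>pendant G e u v\<close>
  have e: "e \<in> edges G" "ends G e = Upair u v" "u \<noteq> v"
    using pend by (auto simp: pendant_def)
  have uv: "u \<in> verts G" "v \<in> verts G" and fin: "finite (verts G)"
    using G e by (auto simp: marked_graph_def)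
  have A: "marked_graph (absorb G e u v)"
    using G pend by (rule marked_graph_absorb_pendant)
  show ?case
  proof (cases "edges G = {e}")
    case True
    \<comment> \<open>The deletion, contraction and absorption are edgeless and agree away from
      \<open>u\<close> and \<open>v\<close>; \<open>?P\<close> is their common factor.\<close>
    let ?P = "\<Prod>x\<in>verts G - {v} - {u}. D_dot (mark_of G x)"
    obtain w d where m: "mark_of G u = (w, d)" by (cases "mark_of G u")
    have "D_poly (delete G e) = D_dot (w, d) * D_dot (1, 0) * ?P"
      using True G fin uv e m less.prems
      by (simp add: D_poly_edgeless marked_graph_delete prod.remove[of _ v] prod.remove[of _ u] mult_ac)
    moreover have "D_poly (contract G e u v) = D_dot (Suc w, Suc d) * ?P"
      using True G fin uv e m less.prems
      by (simp add: D_poly_edgeless marked_graph_contract prod.remove[of _ u] dot_sum_def)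
    moreover have "D_poly (absorb G e u v) = D_dot (Suc w, d) * ?P"
      using True A fin uv e m by (simp add: D_poly_edgeless prod.remove[of _ u])
    ultimately show ?thesis
      using D_poly_nonloop[OF G e] by (simp add: D_dot_Suc_Suc[of w d] algebra_simps)
  next
    case False
    then obtain f where f: "f \<in> edges G" "f \<noteq> e" using e by blast
    have less_card: "card (edges G - {f}) < card (edges G)"
      using G f(1) by (rule card_edges_less)
    have del: "D_poly (delete G f) = D_poly (delete (absorb G e u v) f)"
      using less.hyps[of "delete G f"] less.prems less_card f
      by (simp add: delete_absorb marked_graph_delete pendant_delete)
    have fA: "f \<in> edges (absorb G e u v)" using f by simp
    obtain a b where ab: "ends G f = Upair a b" by (cases "ends G f")
    \<comment> \<open>If \<open>f\<close> is not a loop, its ends are ordered so that contracting it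
      keeps the name \<open>u\<close>.\<close>
    obtain x y where xy: "ends G f = Upair x y" "x = y \<or> y \<noteq> u"
    proof (cases "b = u")
      case True
      then have "ends G f = Upair b a" using ab by auto
      with that[of b a] True show ?thesis by blast
    next
      case False
      with that[of a b] ab show ?thesis by blast
    qed
    have v: "x \<noteq> v" "y \<noteq> v" using pend f xy by (auto simp: pendant_def)
    \<comment> \<open>Since \<open>f\<close> avoids \<open>v\<close>, absorption leaves its ends
      alone, so the same recursion rule applies to \<open>f\<close> in both graphs.\<close>
    have endsA: "ends (absorb G e u v) f = Upair x y" using v xy by simp
    show ?thesis
    proof (cases "x = y")
      case True
      then show ?thesis
        using D_poly_loop[OF G f(1)] D_poly_loop[OF A fA] xy endsA del by simp
    next
      case False
      have "D_poly (contract G f x y) = D_poly (contract (absorb G e u v) f x y)"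
        using less.hyps[of "contract G f x y"] less.prems less_card f xy v e(3) False
        by (simp add: contract_absorb marked_graph_contract pendant_contract)
      then show ?thesis
        using D_poly_nonloop[OF G f(1) xy(1) False] D_poly_nonloop[OF A fA endsA False] del by simp
    qed
  qed
qed

lemma absorb_step_marked_graph_D_poly:
  assumes "absorb_step G H" "marked_graph G"
  shows "marked_graph H \<and> D_poly G = D_poly H"
  using assms
proof cases
  case (1 e u v)
  then show ?thesis
    using assms(2) marked_graph_absorb[of G e u v] D_poly_absorb_pendant[of G e u v]
      absorbable_vertex_pendant[of G e u v]
    by (simp add: absorbable_vertex_def)
qed

theorem theorem5p8:
  fixes G K :: "('v, 'e) mgraph"
  assumes "marked_graph G" and "is_core G K"
  shows "D_poly G = D_poly K"
proof -
  have "absorb_step\<^sup>*\<^sup>* G K" using assms(2) by (simp add: is_core_def)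
  then have "marked_graph K \<and> D_poly G = D_poly K"
    by induction (use assms(1) absorb_step_marked_graph_D_poly in auto)
  then show ?thesis ..
qed

end
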